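(* Let $\omega\in K$ and let $f\in\mathcal F_\omega$. Then $f$ has bounded distortion if and only if the canonical (optimal) modulus of continuity $\omega_{f'}$ of $f'$ is Dini-integrable, i.e. $\int_0^1\frac{\omega_{f'}(t)}{t}\,dt<\infty$.
   Context: $\mathbb R^+=[0,\infty)$; $\mathbb S^1=\mathbb R/\mathbb Z$ with the arc-length metric $d$. $E^1(\mathbb S^1)$ is the set of $C^1$ uniformly expanding maps $f:\mathbb S^1\to\mathbb S^1$ (i.e. $\min|f'|>1$). For a continuous real function $\rho$ on a compact metric space $X$, the canonical modulus of continuity is $\omega_\rho(t)=\sup\{|\rho(x)-\rho(y)|: d(x,y)<t\}$ for $t>0$, with $\omega_\rho(0)=0$. $K$ is the set of continuous, non-decreasing, concave functions $\omega:\mathbb R^+\to\mathbb R^+$ with $\omega(0)=0$ and $\omega\not\equiv0$. For moduli of continuity, $\omega\simeq\tilde\omega$ means that the ratio $\omega/\tilde\omega$ is bounded above and bounded below by positive constants on some interval $(0,t_0]$, $t_0>0$. $E^1_\omega(\mathbb S^1)=\{f\in E^1(\mathbb S^1):\omega_{f'}\simeq\omega\}$. $\mathcal F_\omega$ is the set of maps $f\in E^1_\omega(\mathbb S^1)$ preserving Lebesgue measure which are orientation-preserving of degree 2 with $f(0)=0$, so that they are represented on $[0,1]$ by two full branches $f_1:[0,a]\to[0,1]$ and $f_2:[a,1]\to[0,1]$ for some $a\in(0,1)$, and such that $f_1'(x)=2+2\omega(x)$ for all $x$ in some small interval $[0,t_\omega]$, $t_\omega>0$. For such $f$ and $n\ge1$,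 the injectivity domains $\{\omega^{(n)}_i\}$ of $f^n$ are the intervals of $[0,1]$ which are mapped by $f^n$ onto $[0,1]$ as full branches (the intervals between consecutive points of $f^{-n}(0)$). $f$ has bounded distortion if $$\sup_{n\ge1}\ \sup_{\omega^{(n)}_i}\ \sup_{x,y\in\omega^{(n)}_i}\log\frac{(f^n)'(x)}{(f^n)'(y)}<\infty .$$ *)

theory Defs
  imports "HOL-Analysis.Analysis"
begin

quotient_type circle = real / "\<lambda>x y::real. x - y \<in> \<int>"
proof (rule equivpI)
  show "reflp (\<lambda>x y::real. x - y \<in> \<int>)"
    by (simp add: reflp_def)
  show "symp (\<lambda>x y::real. x - y \<in> \<int>)"
  proof (rule sympI)
    fix x y :: real
    assume "x - y \<in> \<int>"
    then have "- (x - y) \<in> \<int>" by (rule Ints_minus)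
    then show "y - x \<in> \<int>" by simp
  qed
  show "transp (\<lambda>x y::real. x - y \<in> \<int>)"
  proof (rule transpI)
    fix x y z :: real
    assume "x - y \<in> \<int>" "y - z \<in> \<int>"
    then have "(x - y) + (y - z) \<in> \<int>" by (rule Ints_add)
    then show "x - z \<in> \<int>" by simp
  qed
qed

abbreviation circle_of :: "real \<Rightarrow> circle"
  where "circle_of \<equiv> abs_circle"

lemma circle_of_eq_iff: "circle_of a = circle_of b \<longleftrightarrow> a - b \<in> \<int>"
  by (rule circle.abs_eq_iff)

lemma circle_of_surj: "\<exists>a. x = circle_of a"
  by (rule exI[of _ "rep_circle x"]) (rule Quotient_abs_rep[OF Quotient_circle, symmetric])

instantiation circle :: metric_space
begin

definition dist_circle :: "circle \<Rightarrow> circle \<Rightarrow> real"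
  where "dist_circle x y = Inf {\<bar>a - b\<bar> | a b. circle_of a = x \<and> circle_of b = y}"

definition uniformity_circle :: "(circle \<times> circle) filter"
  where "uniformity_circle = (INF e\<in>{0<..}. principal {(x, y). dist x y < e})"

definition open_circle :: "circle set \<Rightarrow> bool"
  where "open_circle U \<longleftrightarrow> (\<forall>x\<in>U. eventually (\<lambda>(x', y). x' = x \<longrightarrow> y \<in> U) uniformity)"

lemma dist_circle_of:
  "dist (circle_of a) (circle_of b) = \<bar>(a - b) - of_int (round (a - b))\<bar>"
  unfolding dist_circle_def
proof (rule cInf_eq_minimum)
  have "circle_of (a - of_int (round (a - b))) = circle_of a"
    by (simp add: circle_of_eq_iff)
  moreover have "\<bar>(a - b) - of_int (round (a - b))\<bar> = \<bar>(a - of_int (round (a - b))) - b\<bar>"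
    by simp
  ultimately show "\<bar>(a - b) - of_int (round (a - b))\<bar>
      \<in> {\<bar>a' - b'\<bar> | a' b'. circle_of a' = circle_of a \<and> circle_of b' = circle_of b}"
    by blast
next
  fix r assume "r \<in> {\<bar>a' - b'\<bar> | a' b'. circle_of a' = circle_of a \<and> circle_of b' = circle_of b}"
  then obtain a' b' where r: "r = \<bar>a' - b'\<bar>" and "a' - a \<in> \<int>" "b' - b \<in> \<int>"
    by (auto simp: circle_of_eq_iff)
  then have "(b' - b) - (a' - a) \<in> \<int>" using Ints_diff by blast
  then obtain m :: int where "(b' - b) - (a' - a) = of_int m" by (auto elim: Ints_cases)
  then have "r = \<bar>(a - b) - of_int m\<bar>" using r by (simp add: algebra_simps)
  then show "\<bar>(a - b) - of_int (round (a - b))\<bar> \<le> r"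
    using round_diff_minimal by blast
qed

instance
proof
  fix x y z :: circle
  obtain a b c where xyz: "x = circle_of a" "y = circle_of b" "z = circle_of c"
    using circle_of_surj[of x] circle_of_surj[of y] circle_of_surj[of z] by blast
  show "dist x y = 0 \<longleftrightarrow> x = y"
  proof -
    have "\<bar>(a - b) - of_int (round (a - b))\<bar> = 0 \<longleftrightarrow> a - b \<in> \<int>"
    proof
      assume "\<bar>(a - b) - of_int (round (a - b))\<bar> = 0"
      then have "a - b = of_int (round (a - b))" by simp
      then show "a - b \<in> \<int>" by (metis Ints_of_int)
    next
      assume "a - b \<in> \<int>"
      then show "\<bar>(a - b) - of_int (round (a - b))\<bar> = 0" by (auto elim!: Ints_cases)
    qed
    then show ?thesis by (simp add: xyz dist_circle_of circle_of_eq_iff)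
  qed
  show "dist x y \<le> dist x z + dist y z"
  proof -
    have "dist x y \<le> \<bar>(a - b) - of_int (round (a - c) - round (b - c))\<bar>"
      unfolding xyz dist_circle_of by (rule round_diff_minimal)
    also have "\<dots> \<le> dist x z + dist y z"
      unfolding xyz dist_circle_of by simp
    finally show ?thesis .
  qed
qed (simp_all add: uniformity_circle_def open_circle_def)

end

definition circle_lebesgue :: "circle measure"
  where "circle_lebesgue = distr (restrict_space lborel {0..<1}) borel circle_of"

definition preserves_measure :: "'a measure \<Rightarrow> ('a \<Rightarrow> 'a) \<Rightarrow> bool"
  where "preserves_measure M f \<longleftrightarrow> f \<in> measurable M M \<and> distr M M f = M"

definition circle_lift :: "(circle \<Rightarrow> circle) \<Rightarrow> (real \<Rightarrow> real) \<Rightarrow> bool"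
  where "circle_lift f F \<longleftrightarrow> continuous_on UNIV F \<and> (\<forall>t. circle_of (F t) = f (circle_of t))"

lemma circle_lift_unique:
  assumes "circle_lift f F" "circle_lift f G"
  shows "\<exists>k::int. \<forall>t. F t = G t + of_int k"
proof -
  have ints: "F t - G t \<in> \<int>" for t
    using assms unfolding circle_lift_def by (simp flip: circle_of_eq_iff)
  have cont: "continuous_on UNIV (\<lambda>t. F t - G t)"
    using assms unfolding circle_lift_def by (intro continuous_on_diff) auto
  have "(\<lambda>t. F t - G t) constant_on UNIV"
  proof (rule continuous_discrete_range_constant[OF connected_UNIV cont])
    fix x
    have "1 \<le> norm ((F y - G y) - (F x - G x))" if "F y - G y \<noteq> F x - G x" for y
    proof -
      have "(F y - G y) - (F x - G x) \<in> \<int>" by (rule Ints_diff[OF ints ints])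
      with that show ?thesis by (simp add: Ints_nonzero_abs_ge1)
    qed
    then show "\<exists>e>0. \<forall>y. y \<in> UNIV \<and> F y - G y \<noteq> F x - G x
        \<longrightarrow> e \<le> norm ((F y - G y) - (F x - G x))"
      using zero_less_one by blast
  qed
  then obtain c where c: "\<And>t. F t - G t = c" by (auto simp: constant_on_def)
  then obtain k :: int where "c = of_int k" using ints[of 0] by (auto elim: Ints_cases)
  then have "\<forall>t. F t = G t + of_int k" using c by (simp add: diff_eq_eq add.commute)
  then show ?thesis ..
qed

text \<open>The derivative of a circle map is that of any lift to the universal cover; by uniqueness of
  lifts up to integer constants the value does not depend on the choice.\<close>

definition has_circle_derivative :: "(circle \<Rightarrow> circle) \<Rightarrow> real \<Rightarrow> circle \<Rightarrow> bool"
  where "has_circle_derivative f D x \<longleftrightarrow>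
    (\<exists>F t. circle_lift f F \<and> circle_of t = x \<and> (F has_real_derivative D) (at t))"

definition circle_deriv :: "(circle \<Rightarrow> circle) \<Rightarrow> circle \<Rightarrow> real"
  where "circle_deriv f x = (THE D. has_circle_derivative f D x)"

lemma has_circle_derivative_unique:
  assumes "has_circle_derivative f D x" "has_circle_derivative f E x"
  shows "D = E"
proof -
  obtain F s where F: "circle_lift f F" "circle_of s = x" "(F has_real_derivative D) (at s)"
    using assms(1) unfolding has_circle_derivative_def by blast
  obtain G t where G: "circle_lift f G" "circle_of t = x" "(G has_real_derivative E) (at t)"
    using assms(2) unfolding has_circle_derivative_def by blast
  have "t - s \<in> \<int>" using F(2) G(2) by (simp flip: circle_of_eq_iff)
  then have shift: "circle_of (u + (t - s)) = circle_of u" for u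
    by (simp add: circle_of_eq_iff)
  have "circle_lift f (\<lambda>u. G (u + (t - s)))"
    using G(1) shift unfolding circle_lift_def
    by (auto intro!: continuous_intros continuous_on_compose2[of UNIV G])
  from circle_lift_unique[OF F(1) this]
  obtain k :: int where k: "\<And>u. F u = G (u + (t - s)) + of_int k" by blast
  have "((\<lambda>u. G (u + (t - s)) + of_int k) has_real_derivative E) (at s)"
    using G(3) DERIV_shift[of G E s "t - s"] by (auto intro!: derivative_eq_intros)
  moreover have F_eq: "F = (\<lambda>u. G (u + (t - s)) + of_int k)" using k by (rule ext)
  ultimately have "(F has_real_derivative E) (at s)" by (simp only: F_eq)
  with F(3) show ?thesis by (rule DERIV_unique)
qed

lemma circle_deriv_eqI: "has_circle_derivative f D x \<Longrightarrow> circle_deriv f x = D"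
  unfolding circle_deriv_def using has_circle_derivative_unique by blast

definition C1_circle_map :: "(circle \<Rightarrow> circle) \<Rightarrow> bool"
  where "C1_circle_map f \<longleftrightarrow> (\<exists>F. circle_lift f F \<and> F C1_differentiable_on UNIV)"

definition circle_degree :: "(circle \<Rightarrow> circle) \<Rightarrow> int \<Rightarrow> bool"
  where "circle_degree f k \<longleftrightarrow> (\<exists>F. circle_lift f F \<and> (\<forall>t. F (t + 1) = F t + of_int k))"

definition orientation_preserving :: "(circle \<Rightarrow> circle) \<Rightarrow> bool"
  where "orientation_preserving f \<longleftrightarrow> (\<exists>F. circle_lift f F \<and> strict_mono F)"

text \<open>The minimum of \<open>\<bar>f'\<bar>\<close> is written as an infimum; it is attained since \<open>f'\<close> is continuous
  and the circle is compact.\<close>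

definition expanding_E1 :: "(circle \<Rightarrow> circle) set"
  where "expanding_E1 = {f. C1_circle_map f \<and> (INF x. \<bar>circle_deriv f x\<bar>) > 1}"

definition canonical_modulus :: "('a::metric_space \<Rightarrow> real) \<Rightarrow> real \<Rightarrow> real"
  where "canonical_modulus \<rho> t =
    (if t > 0 then Sup {\<bar>\<rho> x - \<rho> y\<bar> | x y. dist x y < t} else 0)"

text \<open>Functions on \<open>[0,\<infinity>)\<close> are represented by functions on the reals whose values at negative
  arguments play no role.\<close>

definition moduli_K :: "(real \<Rightarrow> real) set"
  where "moduli_K = {\<omega>. continuous_on {0..} \<omega> \<and> mono_on {0..} \<omega> \<and> concave_on {0..} \<omega> \<and>
    \<omega> ` {0..} \<subseteq> {0..} \<and> \<omega> 0 = 0 \<and> (\<exists>t\<ge>0. \<omega> t \<noteq> 0)}"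

text \<open>Since \<open>x / 0 = 0\<close>, the positive lower bound also forces \<open>\<omega>'\<close> not to vanish on \<open>(0,t\<^sub>0]\<close>.\<close>

definition moduli_equiv :: "(real \<Rightarrow> real) \<Rightarrow> (real \<Rightarrow> real) \<Rightarrow> bool"
  where "moduli_equiv \<omega> \<omega>' \<longleftrightarrow>
    (\<exists>t\<^sub>0>0. \<exists>c>0. \<exists>C>0. \<forall>t\<in>{0<..t\<^sub>0}. c \<le> \<omega> t / \<omega>' t \<and> \<omega> t / \<omega>' t \<le> C)"

definition expanding_E1_modulus :: "(real \<Rightarrow> real) \<Rightarrow> (circle \<Rightarrow> circle) set"
  where "expanding_E1_modulus \<omega> =
    {f \<in> expanding_E1. moduli_equiv (canonical_modulus (circle_deriv f)) \<omega>}"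

definition Dini_integrable :: "(real \<Rightarrow> real) \<Rightarrow> bool"
  where "Dini_integrable \<omega> \<longleftrightarrow> (\<integral>\<^sup>+t\<in>{0..1}. ennreal (\<omega> t / t) \<partial>lborel) < \<infinity>"

definition full_branch :: "(circle \<Rightarrow> circle) \<Rightarrow> real set \<Rightarrow> (real \<Rightarrow> real) \<Rightarrow> bool"
  where "full_branch f J g \<longleftrightarrow> continuous_on J g \<and> strict_mono_on J g \<and> g ` J = {0..1} \<and>
    (\<forall>t\<in>J. circle_of (g t) = f (circle_of t))"

text \<open>The derivative of the branch \<open>f\<^sub>1\<close> is taken within its domain \<open>[0,a]\<close>,
  hence one-sided at the endpoints.\<close>

definition class_F :: "(real \<Rightarrow> real) \<Rightarrow> (circle \<Rightarrow> circle) set"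
  where "class_F \<omega> = {f \<in> expanding_E1_modulus \<omega>.
    preserves_measure circle_lebesgue f \<and> orientation_preserving f \<and> circle_degree f 2 \<and>
    f (circle_of 0) = circle_of 0 \<and>
    (\<exists>a\<in>{0<..<1}. \<exists>f\<^sub>1 f\<^sub>2. full_branch f {0..a} f\<^sub>1 \<and> full_branch f {a..1} f\<^sub>2 \<and>
      (\<exists>t\<^sub>\<omega>>0. t\<^sub>\<omega> \<le> a \<and>
        (\<forall>t\<in>{0..t\<^sub>\<omega>}. (f\<^sub>1 has_real_derivative 2 + 2 * \<omega> t) (at t within {0..a}))))}"

definition injectivity_domains :: "(circle \<Rightarrow> circle) \<Rightarrow> nat \<Rightarrow> real set set"
  where "injectivity_domains f n = {{p..q} | p q. 0 \<le> p \<and> p < q \<and> q \<le> 1 \<and>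
    (f ^^ n) (circle_of p) = circle_of 0 \<and> (f ^^ n) (circle_of q) = circle_of 0 \<and>
    (\<forall>t\<in>{p<..<q}. (f ^^ n) (circle_of t) \<noteq> circle_of 0)}"

text \<open>The suprema are taken in the extended reals, where being less than \<open>\<infinity>\<close> is
  a genuine boundedness condition.\<close>

definition bounded_distortion :: "(circle \<Rightarrow> circle) \<Rightarrow> bool"
  where "bounded_distortion f \<longleftrightarrow>
    (SUP n\<in>{1..}. SUP J\<in>injectivity_domains f n. SUP (s, t)\<in>J \<times> J.
      ereal (ln (circle_deriv (f ^^ n) (circle_of s) / circle_deriv (f ^^ n) (circle_of t)))) < \<infinity>"

end

theory Submission
  imports Defs
begin

text \<open>
  Both conditions amount to the convergence of one series, namely the values of the modulus
  \<open>\<Omega>\<close> of \<open>f'\<close> along a geometric sequence. Cutting \<open>(0,1]\<close> at the powers of any \<open>q \<in> (0,1)\<close>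
  turns the Dini integral of the monotone function \<open>\<Omega>\<close> into \<open>\<Sum>\<^sub>j \<Omega> (q\<^sup>j)\<close>, up to constants
  (\<open>Dini_integrable_iff_summable_geometric\<close>). The freedom in \<open>q\<close> matters: the two implications
  use different ratios.

  Let \<open>F\<close> be the lift of \<open>f\<close> with \<open>F 0 = 0\<close>, let \<open>D\<close> be its derivative and let
  \<open>1 < \<mu> \<le> D \<le> B\<close>.

  If \<open>\<Omega>\<close> is Dini, compare two orbits that start in one injectivity domain of \<open>f\<^sup>n\<close>. Their
  distance is at most \<open>1\<close> at time \<open>n\<close>, so by expansion it is at most \<open>\<mu>\<^sup>-\<^sup>(\<^sup>n\<^sup>-\<^sup>k\<^sup>)\<close> at time \<open>k\<close>. By the
  chain rule the logarithm of the distortion is a sum of terms bounded by \<open>\<Omega>\<close> at these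
  distances, hence by the full series with \<open>q = 1/\<mu>\<close> (\<open>bounded_distortion_if_Dini\<close>).

  Conversely, follow the fixed point \<open>0\<close>. Let \<open>p\<^sub>0 = 1\<close> and \<open>F p\<^sub>n\<^sub>+\<^sub>1 = p\<^sub>n\<close>, so that \<open>[0,p\<^sub>n]\<close> is
  an injectivity domain of \<open>f\<^sup>n\<close>. The distortion between its endpoints is
  \<open>\<Prod>\<^sub>k D p\<^sub>k / D 0\<close>, whose factors are \<open>1 + \<omega> p\<^sub>k\<close> as soon as \<open>p\<^sub>k\<close> lies in the interval on
  which \<open>f' = 2 + 2 \<omega>\<close>. All these factors are at least \<open>1\<close>, so nothing can cancel, and bounded
  distortion forces \<open>\<Sum> \<omega> p\<^sub>k < \<infinity>\<close>. Since \<open>p\<^sub>k\<close> cannot shrink faster than \<open>B\<^sup>-\<^sup>k\<close>,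
  also \<open>\<Sum> \<omega> (B\<^sup>-\<^sup>k) < \<infinity>\<close> (\<open>summable_modulus_at_fixed_point\<close>), and \<open>\<Omega> \<simeq> \<omega>\<close> gives the Dini
  condition.
\<close>

section \<open>Dini integrals and geometric sampling\<close>

text \<open>On \<open>(q\<^sup>j\<^sup>+\<^sup>1, q\<^sup>j]\<close> the integrand is squeezed between multiples of \<open>\<Omega> (q\<^sup>j\<^sup>+\<^sup>1)\<close> and \<open>\<Omega> (q\<^sup>j)\<close> by
  \<open>q\<^sup>-\<^sup>j\<close>, while the length of the interval is \<open>q\<^sup>j (1 - q)\<close>. The comparison is made pointwise with
  step functions, so that countable additivity is applied to measurable functions only.\<close>

lemma Dini_integrable_iff_summable_geometric:
  fixes \<Omega> :: "real \<Rightarrow> real" and q :: real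
  assumes nonneg: "\<And>t. 0 < t \<Longrightarrow> 0 \<le> \<Omega> t"
    and mono: "\<And>s t. 0 < s \<Longrightarrow> s \<le> t \<Longrightarrow> \<Omega> s \<le> \<Omega> t"
    and q: "0 < q" "q < 1"
  shows "Dini_integrable \<Omega> \<longleftrightarrow> summable (\<lambda>j. \<Omega> (q ^ j))"
proof -
  define I where "I j = {q ^ Suc j <.. q ^ j}" for j
  have q_le: "q ^ Suc j \<le> q ^ j" for j
    using q by (intro power_decreasing) auto
  have len: "emeasure lborel (I j) = ennreal (q ^ j * (1 - q))" for j
    unfolding I_def using q_le[of j] by (simp add: algebra_simps)
  have integral_step: "(\<integral>\<^sup>+t. (\<Sum>j. ennreal (c j) * indicator (I j) t) \<partial>lborel)
      = (\<Sum>j. ennreal (c j * (q ^ j * (1 - q))))" if "\<And>j. 0 \<le> c j" for c :: "nat \<Rightarrow> real"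
  proof -
    have "(\<integral>\<^sup>+t. (\<Sum>j. ennreal (c j) * indicator (I j) t) \<partial>lborel)
        = (\<Sum>j. \<integral>\<^sup>+t. ennreal (c j) * indicator (I j) t \<partial>lborel)"
      by (intro nn_integral_suminf) (auto simp: I_def)
    also have "\<dots> = (\<Sum>j. ennreal (c j) * emeasure lborel (I j))"
      by (intro suminf_cong nn_integral_cmult_indicator) (auto simp: I_def)
    also have "\<dots> = (\<Sum>j. ennreal (c j * (q ^ j * (1 - q))))"
      using that q by (simp add: len ennreal_mult)
    finally show ?thesis .
  qed
  show ?thesis
  proof
    assume "summable (\<lambda>j. \<Omega> (q ^ j))"
    define c where "c j = \<Omega> (q ^ j) / q ^ Suc j" for j
    have c_nonneg: "0 \<le> c j" for j
      using nonneg[of "q ^ j"] q by (simp add: c_def)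
    have pointwise: "ennreal (\<Omega> t / t) * indicator {0..1} t
        \<le> (\<Sum>j. ennreal (c j) * indicator (I j) t)" for t
    proof (cases "0 < t \<and> t \<le> 1")
      case True
      obtain n where n: "q ^ n < t" "\<And>m. m < n \<Longrightarrow> \<not> q ^ m < t"
        using real_arch_pow_inv[of t q] True q exists_least_iff[of "\<lambda>n. q ^ n < t"] by auto
      then obtain j where "n = Suc j"
        using True by (cases n) auto
      with n have j: "q ^ Suc j < t" "t \<le> q ^ j"
        by (auto simp: not_less)
      have "\<Omega> t / t \<le> c j"
        unfolding c_def using True j q nonneg[of t] mono[of t "q ^ j"]
        by (intro frac_le) auto
      then have "ennreal (\<Omega> t / t) * indicator {0..1} t \<le> ennreal (c j) * indicator (I j) t"
        using True j by (simp add: I_def ennreal_leI)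
      also have "\<dots> \<le> (\<Sum>j. ennreal (c j) * indicator (I j) t)"
      proof -
        have "h j \<le> suminf h" for h :: "nat \<Rightarrow> ennreal"
          using sum_le_suminf[OF summableI, of "{j}" h] by simp
        then show ?thesis .
      qed
      finally show ?thesis .
    next
      case False
      then show ?thesis by (cases "t = 0") (auto simp: indicator_def)
    qed
    have "(\<integral>\<^sup>+t\<in>{0..1}. ennreal (\<Omega> t / t) \<partial>lborel)
        \<le> (\<integral>\<^sup>+t. (\<Sum>j. ennreal (c j) * indicator (I j) t) \<partial>lborel)"
      by (intro nn_integral_mono pointwise)
    also have "\<dots> = (\<Sum>j. ennreal (c j * (q ^ j * (1 - q))))"
      by (rule integral_step[OF c_nonneg])
    also have "c j * (q ^ j * (1 - q)) = \<Omega> (q ^ j) * ((1 - q) / q)" for j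
      using q by (simp add: c_def)
    then have "(\<Sum>j. ennreal (c j * (q ^ j * (1 - q)))) = (\<Sum>j. ennreal (\<Omega> (q ^ j) * ((1 - q) / q)))"
      by simp
    also have "\<dots> < \<infinity>"
      using \<open>summable (\<lambda>j. \<Omega> (q ^ j))\<close> q nonneg
      by (subst suminf_ennreal2) (auto intro!: summable_mult2 mult_nonneg_nonneg)
    finally show "Dini_integrable \<Omega>"
      unfolding Dini_integrable_def .
  next
    assume Dini: "Dini_integrable \<Omega>"
    define c where "c j = \<Omega> (q ^ Suc j) / q ^ j" for j
    have c_nonneg: "0 \<le> c j" for j
      using nonneg[of "q ^ Suc j"] q by (simp add: c_def)
    have disj: "\<not> i < j" if "t \<in> I i" "t \<in> I j" for t i j
    proof
      assume "i < j"
      then have "q ^ j \<le> q ^ Suc i"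
        using q by (intro power_decreasing) auto
      with that show False by (auto simp: I_def)
    qed
    have pointwise: "(\<Sum>j. ennreal (c j) * indicator (I j) t)
        \<le> ennreal (\<Omega> t / t) * indicator {0..1} t" for t
    proof (cases "\<exists>j. t \<in> I j")
      case True
      then obtain j where j: "t \<in> I j" by blast
      have "indicator (I i) t = (0 :: ennreal)" if "i \<noteq> j" for i
        using disj[of t i j] disj[of t j i] j that by (auto simp: indicator_def neq_iff)
      then have "(\<Sum>i. ennreal (c i) * indicator (I i) t) = (\<Sum>i\<in>{j}. ennreal (c i) * indicator (I i) t)"
        by (intro suminf_finite) simp_all
      then have "(\<Sum>i. ennreal (c i) * indicator (I i) t) = ennreal (c j) * indicator (I j) t"
        by (simp only: sum.insert sum.empty finite.emptyI empty_iff not_False_eq_True add_0_right)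
      also have "\<dots> = ennreal (c j)"
        using j by simp
      also have "\<dots> \<le> ennreal (\<Omega> t / t)"
      proof (intro ennreal_leI)
        have t: "q ^ Suc j < t" "t \<le> q ^ j" "0 < q ^ Suc j"
          using j q by (auto simp: I_def)
        then have "0 < t" by linarith
        then show "c j \<le> \<Omega> t / t"
          unfolding c_def using t mono[of "q ^ Suc j" t] nonneg[of t]
          by (intro frac_le) auto
      qed
      also have "\<dots> = ennreal (\<Omega> t / t) * indicator {0..1} t"
      proof -
        have "0 < q ^ Suc j" "q ^ j \<le> 1"
          using q by (auto intro: power_le_one)
        with j have "0 \<le> t" "t \<le> 1"
          by (auto simp: I_def)
        then show ?thesis by simp
      qed
      finally show ?thesis .
    next
      case False
      then show ?thesis by (simp add: indicator_def)
    qed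
    have "\<Omega> (q ^ Suc j) * (1 - q) = c j * (q ^ j * (1 - q))" for j
      using q by (simp add: c_def)
    then have "(\<Sum>j. ennreal (\<Omega> (q ^ Suc j) * (1 - q))) = (\<Sum>j. ennreal (c j * (q ^ j * (1 - q))))"
      by (simp only:)
    also have "\<dots> = (\<integral>\<^sup>+t. (\<Sum>j. ennreal (c j) * indicator (I j) t) \<partial>lborel)"
      by (rule integral_step[OF c_nonneg, symmetric])
    also have "\<dots> \<le> (\<integral>\<^sup>+t\<in>{0..1}. ennreal (\<Omega> t / t) \<partial>lborel)"
      by (intro nn_integral_mono pointwise)
    also have "\<dots> < \<infinity>"
      using Dini unfolding Dini_integrable_def .
    finally have "summable (\<lambda>j. \<Omega> (q ^ Suc j) * (1 - q))"
      using q nonneg by (intro summable_suminf_not_top) (auto intro!: mult_nonneg_nonneg)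
    then have "summable (\<lambda>j. \<Omega> (q ^ Suc j) * (1 - q) * inverse (1 - q))"
      by (rule summable_mult2)
    then have "summable (\<lambda>j. \<Omega> (q ^ Suc j))"
      using q by (simp only: mult.assoc) simp
    then show "summable (\<lambda>j. \<Omega> (q ^ j))"
      using summable_Suc_iff[of "\<lambda>j. \<Omega> (q ^ j)"] by (simp only:)
  qed
qed

section \<open>The canonical modulus of continuity\<close>

lemma canonical_modulus_bdd:
  fixes \<rho> :: "'a::metric_space \<Rightarrow> real"
  assumes "\<And>x. \<bar>\<rho> x\<bar> \<le> B"
  shows "bdd_above {\<bar>\<rho> x - \<rho> y\<bar> | x y. dist x y < t}"
proof (rule bdd_aboveI[of _ "2 * B"])
  fix r assume "r \<in> {\<bar>\<rho> x - \<rho> y\<bar> | x y. dist x y < t}"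
  then obtain x y where "r = \<bar>\<rho> x - \<rho> y\<bar>" by blast
  then show "r \<le> 2 * B" using assms[of x] assms[of y] by linarith
qed

lemma abs_diff_le_canonical_modulus:
  fixes \<rho> :: "'a::metric_space \<Rightarrow> real"
  assumes "\<And>x. \<bar>\<rho> x\<bar> \<le> B" and "dist x y < t"
  shows "\<bar>\<rho> x - \<rho> y\<bar> \<le> canonical_modulus \<rho> t"
proof -
  have "0 < t" using assms(2) zero_le_dist[of x y] by linarith
  then show ?thesis
    unfolding canonical_modulus_def using assms(2)
    by (auto intro!: cSup_upper canonical_modulus_bdd[OF assms(1)])
qed

lemma canonical_modulus_nonneg:
  fixes \<rho> :: "'a::metric_space \<Rightarrow> real"
  assumes "\<And>x. \<bar>\<rho> x\<bar> \<le> B" and "0 < t"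
  shows "0 \<le> canonical_modulus \<rho> t"
  using abs_diff_le_canonical_modulus[OF assms(1), of undefined undefined t] assms(2) by simp

lemma canonical_modulus_mono:
  fixes \<rho> :: "'a::metric_space \<Rightarrow> real"
  assumes "\<And>x. \<bar>\<rho> x\<bar> \<le> B" and "0 < s" "s \<le> t"
  shows "canonical_modulus \<rho> s \<le> canonical_modulus \<rho> t"
proof -
  have "\<bar>\<rho> undefined - \<rho> undefined\<bar> \<in> {\<bar>\<rho> x - \<rho> y\<bar> | x y. dist x y < s}"
    using assms(2) by force
  then have "Sup {\<bar>\<rho> x - \<rho> y\<bar> | x y. dist x y < s} \<le> Sup {\<bar>\<rho> x - \<rho> y\<bar> | x y. dist x y < t}"
    using assms(3)
    by (intro cSup_subset_mono canonical_modulus_bdd[OF assms(1)]) (blast intro: less_le_trans)+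
  then show ?thesis
    using assms(2,3) by (simp add: canonical_modulus_def)
qed

lemma dist_circle_of_le: "dist (circle_of a) (circle_of b) \<le> \<bar>a - b\<bar>"
  unfolding dist_circle_of using round_diff_minimal[of "a - b" 0] by simp

section \<open>Distortion\<close>

text \<open>A supremum in the extended reals is below \<open>\<infinity>\<close> exactly if it has a real upper bound.\<close>

lemma bounded_distortion_iff:
  "bounded_distortion f \<longleftrightarrow> (\<exists>C. \<forall>n\<ge>1. \<forall>J\<in>injectivity_domains f n. \<forall>s\<in>J. \<forall>t\<in>J.
      ln (circle_deriv (f ^^ n) (circle_of s) / circle_deriv (f ^^ n) (circle_of t)) \<le> C)"
  (is "_ \<longleftrightarrow> (\<exists>C. ?bounded C)")
proof -
  let ?sup = "SUP n\<in>{1..}. SUP J\<in>injectivity_domains f n. SUP (s, t)\<in>J \<times> J.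
      ereal (ln (circle_deriv (f ^^ n) (circle_of s) / circle_deriv (f ^^ n) (circle_of t)))"
  have bounded_by: "?sup \<le> ereal C \<longleftrightarrow> ?bounded C" for C
    by (auto simp: SUP_le_iff)
  have "?sup < \<infinity> \<longleftrightarrow> (\<exists>C. ?sup \<le> ereal C)"
  proof
    assume "?sup < \<infinity>"
    then have "?sup \<noteq> \<infinity>" by (rule less_imp_neq)
    then obtain n :: nat where "?sup < ereal (real n)"
      unfolding less_PInf_Ex_of_nat ..
    then show "\<exists>C. ?sup \<le> ereal C"
      using less_imp_le by blast
  next
    assume "\<exists>C. ?sup \<le> ereal C"
    then obtain C where "?sup \<le> ereal C" ..
    also have "ereal C < \<infinity>" by simp
    finally show "?sup < \<infinity>" .
  qed
  then show ?thesis
    unfolding bounded_distortion_def bounded_by .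
qed

section \<open>Expanding circle maps through their lifts\<close>

text \<open>All dynamics take place on the real line: derivatives, order and distances of the lift
  are elementary there, and \<open>D\<close> descends to the circle as the derivative of \<open>f\<close>.\<close>

locale expanding_lift =
  fixes f :: "circle \<Rightarrow> circle" and F D :: "real \<Rightarrow> real" and \<mu> :: real
  assumes lift: "circle_lift f F"
    and deriv: "\<And>t. (F has_real_derivative D t) (at t)"
    and cont_D: "continuous_on UNIV D"
    and rate_gt_1: "1 < \<mu>"
    and rate_le_D: "\<And>t. \<mu> \<le> D t"
begin

lemma D_pos: "0 < D t"
  using rate_le_D[of t] rate_gt_1 by linarith

lemma D_nonzero: "D t \<noteq> 0"
  using D_pos[of t] by simp

lemma lift_funpow: "circle_lift (f ^^ n) (F ^^ n)"
proof (induction n)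
  case 0
  show ?case by (simp add: circle_lift_def)
next
  case (Suc n)
  with lift show ?case
    unfolding circle_lift_def by (auto intro: continuous_on_compose2[of UNIV F])
qed

lemma deriv_funpow: "((F ^^ n) has_real_derivative (\<Prod>k<n. D ((F ^^ k) t))) (at t)"
proof (induction n)
  case 0
  show ?case by (simp add: id_def)
next
  case (Suc n)
  then show ?case
    using DERIV_chain[OF deriv[of "(F ^^ n) t"] Suc]
    by (simp only: funpow.simps prod.lessThan_Suc mult.commute)
qed

lemma circle_deriv_funpow: "circle_deriv (f ^^ n) (circle_of t) = (\<Prod>k<n. D ((F ^^ k) t))"
  using lift_funpow deriv_funpow
  by (intro circle_deriv_eqI) (unfold has_circle_derivative_def, blast)

lemma circle_deriv_eq: "circle_deriv f (circle_of t) = D t"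
  using circle_deriv_funpow[of 1 t] by simp

lemma D_bounded: obtains B where "1 < B" "\<And>t. D t \<le> B"
proof -
  have "compact (D ` {0..1})"
    using cont_D by (intro compact_continuous_image continuous_on_subset[OF cont_D]) auto
  then obtain B where B: "\<And>t. t \<in> {0..1} \<Longrightarrow> \<bar>D t\<bar> \<le> B"
    using compact_imp_bounded[of "D ` {0..1}"] by (force simp: bounded_iff)
  have "D t \<le> B" for t
  proof -
    \<comment> \<open>\<open>D\<close> is \<open>1\<close>-periodic because it is the pullback of a function on the circle.\<close>
    have "circle_of (frac t) = circle_of t"
      by (simp add: circle_of_eq_iff frac_def)
    then have "D t = D (frac t)"
      by (metis circle_deriv_eq)
    then show ?thesis
      using B[of "frac t"] frac_lt_1[of t] by (simp add: less_imp_le abs_le_iff)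
  qed
  moreover from this[of 0] have "1 < B"
    using rate_le_D[of 0] rate_gt_1 by linarith
  ultimately show thesis using that by blast
qed

lemma circle_deriv_bounded: obtains B where "\<And>x. \<bar>circle_deriv f x\<bar> \<le> B"
proof -
  obtain B where "\<And>t. D t \<le> B" using D_bounded by blast
  then have "\<bar>circle_deriv f x\<bar> \<le> B" for x
    using circle_of_surj[of x] D_pos circle_deriv_eq by (metis abs_of_pos)
  then show thesis using that by blast
qed

lemma mean_value:
  assumes "s < t"
  obtains z where "F t - F s = D z * (t - s)"
  using MVT2[OF assms deriv] by (auto simp: mult.commute)

lemma expands:
  assumes "s \<le> t"
  shows "\<mu> * (t - s) \<le> F t - F s"
proof (cases "s = t")
  case False
  then obtain z where "F t - F s = D z * (t - s)"
    using mean_value[of s t] assms by auto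
  then show ?thesis
    using rate_le_D[of z] assms by (simp add: mult_right_mono)
qed simp

lemma strict_mono_F: "strict_mono F"
proof (rule strict_monoI)
  fix s t :: real assume "s < t"
  then obtain z where "F t - F s = D z * (t - s)"
    using mean_value by blast
  moreover have "0 < D z * (t - s)"
    using D_pos \<open>s < t\<close> by simp
  ultimately show "F s < F t" by simp
qed

lemma strict_mono_funpow: "strict_mono (F ^^ n)"
  by (induction n) (use strict_mono_F in \<open>auto simp: strict_mono_def\<close>)

lemma funpow_expands: "s \<le> t \<Longrightarrow> \<mu> ^ n * (t - s) \<le> (F ^^ n) t - (F ^^ n) s"
proof (induction n)
  case (Suc n)
  have "(F ^^ n) s \<le> (F ^^ n) t"
    using strict_mono_funpow Suc.prems by (simp add: strict_mono_less_eq)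
  then have "\<mu> * ((F ^^ n) t - (F ^^ n) s) \<le> (F ^^ Suc n) t - (F ^^ Suc n) s"
    using expands by simp
  moreover have "\<mu> * (\<mu> ^ n * (t - s)) \<le> \<mu> * ((F ^^ n) t - (F ^^ n) s)"
    using Suc rate_gt_1 by (intro mult_left_mono) auto
  ultimately show ?case by (simp add: mult.assoc)
qed simp

text \<open>The endpoints of the domain have integer images under the lifted iterate. If these differed
  by more than \<open>1\<close>, the intermediate value theorem would give an interior point with an integer
  image, that is, an interior preimage of the base point.\<close>

lemma image_of_injectivity_domain:
  assumes "J \<in> injectivity_domains f n" "s \<in> J" "t \<in> J"
  shows "\<bar>(F ^^ n) t - (F ^^ n) s\<bar> \<le> 1"
proof -
  obtain p q where J: "J = {p..q}" and pq: "p < q"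
    and ends: "(f ^^ n) (circle_of p) = circle_of 0" "(f ^^ n) (circle_of q) = circle_of 0"
    and inner: "\<And>t. t \<in> {p<..<q} \<Longrightarrow> (f ^^ n) (circle_of t) \<noteq> circle_of 0"
    using assms(1) unfolding injectivity_domains_def by blast
  have lifted: "(f ^^ n) (circle_of t) = circle_of 0 \<longleftrightarrow> (F ^^ n) t \<in> \<int>" for t
    using lift_funpow[of n] circle_of_eq_iff[of "(F ^^ n) t" 0] by (simp add: circle_lift_def)
  have "(F ^^ n) q - (F ^^ n) p \<le> 1"
  proof (rule ccontr)
    assume "\<not> ?thesis"
    then have "(F ^^ n) p < (F ^^ n) p + 1" "(F ^^ n) p + 1 < (F ^^ n) q" by auto
    moreover have "continuous_on {p..q} (F ^^ n)"
      using lift_funpow[of n] continuous_on_subset unfolding circle_lift_def by blast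
    ultimately obtain z where z: "p \<le> z" "z \<le> q" "(F ^^ n) z = (F ^^ n) p + 1"
      using IVT'[of "F ^^ n" p "(F ^^ n) p + 1" q] pq by auto
    then have "z \<in> {p<..<q}"
      using \<open>(F ^^ n) p + 1 < (F ^^ n) q\<close> by (cases "z = p"; cases "z = q") auto
    moreover have "(F ^^ n) z \<in> \<int>"
      using ends(1) z(3) lifted by simp
    ultimately show False using inner lifted by blast
  qed
  moreover have "(F ^^ n) p \<le> (F ^^ n) u \<and> (F ^^ n) u \<le> (F ^^ n) q" if "u \<in> J" for u
    using that J strict_mono_funpow[of n] by (simp add: strict_mono_less_eq)
  ultimately show ?thesis
    using assms(2,3) by (smt (verit))
qed

text \<open>Expansion over the remaining \<open>n - k\<close> steps, which end at distance at most \<open>1\<close>, bounds the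
  distance at time \<open>k\<close> by \<open>(1 / \<mu>) ^ (n - k)\<close>. One power is given up to make the inequality strict,
  because the canonical modulus at \<open>r\<close> only controls pairs at distance less than \<open>r\<close>.\<close>

lemma orbits_contract_backwards:
  assumes "J \<in> injectivity_domains f n" "s \<in> J" "t \<in> J" "k < n"
  shows "\<bar>(F ^^ k) t - (F ^^ k) s\<bar> < (1 / \<mu>) ^ (n - Suc k)"
proof -
  have *: "(F ^^ k) v - (F ^^ k) u < (1 / \<mu>) ^ (n - Suc k)" if uv: "u \<in> J" "v \<in> J" "u \<le> v" for u v
  proof -
    have "(F ^^ k) u \<le> (F ^^ k) v"
      using strict_mono_funpow uv by (simp add: strict_mono_less_eq)
    from funpow_expands[OF this, of "n - k"]
    have "\<mu> ^ (n - k) * ((F ^^ k) v - (F ^^ k) u) \<le> (F ^^ n) v - (F ^^ n) u"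
      using assms(4) by (simp flip: comp_apply[of "F ^^ (n - k)" "F ^^ k"] funpow_add)
    also have "\<dots> \<le> 1"
      using image_of_injectivity_domain[OF assms(1) uv(1,2)] by linarith
    finally have "(F ^^ k) v - (F ^^ k) u \<le> (1 / \<mu>) ^ (n - k)"
      using rate_gt_1 by (simp add: field_simps power_one_over)
    also have "\<dots> < (1 / \<mu>) ^ (n - Suc k)"
      using rate_gt_1 assms(4) by (intro power_strict_decreasing) auto
    finally show ?thesis .
  qed
  show ?thesis
    using *[of s t] *[of t s] assms(2,3) strict_mono_funpow[of k]
    by (smt (verit) strict_mono_less_eq)
qed

lemma modulus_nonneg: "0 < t \<Longrightarrow> 0 \<le> canonical_modulus (circle_deriv f) t"
  using circle_deriv_bounded canonical_modulus_nonneg[of "circle_deriv f"] by blast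

lemma abs_D_diff_le:
  assumes "\<bar>s - t\<bar> < r"
  shows "\<bar>D s - D t\<bar> \<le> canonical_modulus (circle_deriv f) r"
proof -
  obtain B where B: "\<And>x. \<bar>circle_deriv f x\<bar> \<le> B" using circle_deriv_bounded by blast
  from abs_diff_le_canonical_modulus[of "circle_deriv f", OF B, of "circle_of s" "circle_of t" r]
  show ?thesis using dist_circle_of_le[of s t] assms by (simp add: circle_deriv_eq)
qed

lemma Dini_modulus_iff_summable:
  assumes "0 < q" "q < 1"
  shows "Dini_integrable (canonical_modulus (circle_deriv f))
    \<longleftrightarrow> summable (\<lambda>j. canonical_modulus (circle_deriv f) (q ^ j))"
proof -
  obtain B where B: "\<And>x. \<bar>circle_deriv f x\<bar> \<le> B" using circle_deriv_bounded by blast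
  from canonical_modulus_mono[of "circle_deriv f", OF B] modulus_nonneg assms
  show ?thesis by (intro Dini_integrable_iff_summable_geometric) auto
qed

section \<open>Dini integrability implies bounded distortion\<close>

text \<open>The bound is the sum of the whole series, hence uniform in \<open>n\<close> and in the domain: the
  terms of the chain rule, read backwards from time \<open>n\<close>, are dominated by a partial sum of it.
  The logarithm is linearised by \<open>ln x \<le> x - 1\<close>.\<close>

lemma bounded_distortion_if_Dini:
  assumes "Dini_integrable (canonical_modulus (circle_deriv f))"
  shows "bounded_distortion f"
proof -
  define \<Omega> where "\<Omega> j = canonical_modulus (circle_deriv f) ((1 / \<mu>) ^ j)" for j
  have summable: "summable \<Omega>"
    unfolding \<Omega>_def using assms Dini_modulus_iff_summable[of "1 / \<mu>"] rate_gt_1 by simp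
  have \<Omega>_nonneg: "0 \<le> \<Omega> j" for j
    unfolding \<Omega>_def using rate_gt_1 by (intro modulus_nonneg) simp
  have "ln (circle_deriv (f ^^ n) (circle_of s) / circle_deriv (f ^^ n) (circle_of t)) \<le> suminf \<Omega>"
    if J: "J \<in> injectivity_domains f n" "s \<in> J" "t \<in> J" for n J s t
  proof -
    let ?d = "\<lambda>k u. D ((F ^^ k) u)"
    have "ln (circle_deriv (f ^^ n) (circle_of s) / circle_deriv (f ^^ n) (circle_of t))
        = ln (\<Prod>k<n. ?d k s / ?d k t)"
      by (simp add: circle_deriv_funpow prod_dividef)
    also have "\<dots> = (\<Sum>k<n. ln (?d k s / ?d k t))"
      by (intro ln_prod) (simp_all add: D_pos D_nonzero)
    also have "\<dots> \<le> (\<Sum>k<n. \<Omega> (n - Suc k))"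
    proof (rule sum_mono)
      fix k assume "k \<in> {..<n}"
      then have close: "\<bar>(F ^^ k) s - (F ^^ k) t\<bar> < (1 / \<mu>) ^ (n - Suc k)"
        using orbits_contract_backwards[OF J(1,3,2)] by simp
      have "ln (?d k s / ?d k t) \<le> ?d k s / ?d k t - 1"
        using D_pos by (intro ln_le_minus_one) simp
      also have "\<dots> = (?d k s - ?d k t) / ?d k t"
        using D_pos[of "(F ^^ k) t"] by (simp add: field_simps)
      also have "\<dots> \<le> \<bar>?d k s - ?d k t\<bar> / ?d k t"
        using D_pos[of "(F ^^ k) t"] by (intro divide_right_mono) auto
      also have "\<dots> \<le> \<bar>?d k s - ?d k t\<bar> / 1"
        using rate_gt_1 rate_le_D[of "(F ^^ k) t"] by (intro divide_left_mono) auto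
      also have "\<dots> \<le> \<Omega> (n - Suc k)"
        unfolding \<Omega>_def using abs_D_diff_le[OF close] by simp
      finally show "ln (?d k s / ?d k t) \<le> \<Omega> (n - Suc k)" .
    qed
    also have "\<dots> = (\<Sum>j<n. \<Omega> j)"
      by (rule sum.nat_diff_reindex)
    also have "\<dots> \<le> suminf \<Omega>"
      using summable \<Omega>_nonneg by (intro sum_le_suminf) auto
    finally show ?thesis .
  qed
  then show ?thesis
    unfolding bounded_distortion_iff by blast
qed

section \<open>Bounded distortion implies Dini integrability\<close>

lemma fixed_funpow: "F 0 = 0 \<Longrightarrow> (F ^^ n) 0 = 0"
  by (induction n) auto

text \<open>Since \<open>F\<close> maps \<open>[0,1]\<close> over itself, one can keep pulling back the point \<open>1\<close> inside \<open>(0,1]\<close>;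
  this follows the inverse branch that fixes \<open>0\<close>.\<close>

lemma backward_orbit:
  assumes F0: "F 0 = 0"
  obtains p :: "nat \<Rightarrow> real"
  where "p 0 = 1" "\<And>n. F (p (Suc n)) = p n" "\<And>n. 0 < p n" "\<And>n. p n \<le> 1"
proof -
  have "\<exists>x. F x = y \<and> 0 < x \<and> x \<le> 1" if y: "0 < y \<and> y \<le> 1" for y
  proof -
    have "1 \<le> F 1" using expands[of 0 1] F0 rate_gt_1 by simp
    moreover have "continuous_on {0..1} F"
      using lift continuous_on_subset unfolding circle_lift_def by blast
    ultimately obtain x where x: "0 \<le> x" "x \<le> 1" "F x = y"
      using IVT'[of F 0 y 1] F0 y by auto
    with y F0 have "x \<noteq> 0" by auto
    with x show ?thesis by force
  qed
  then obtain G where G: "\<And>y. 0 < y \<and> y \<le> 1 \<Longrightarrow> F (G y) = y \<and> 0 < G y \<and> G y \<le> 1"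
    by metis
  define p where "p n = (G ^^ n) 1" for n
  have p_bounds: "0 < p n \<and> p n \<le> 1" for n
    by (induction n) (use G in \<open>auto simp: p_def\<close>)
  show thesis
  proof (rule that[of p])
    show "F (p (Suc n)) = p n" for n
      using G[OF p_bounds[of n]] by (simp add: p_def)
  qed (use p_bounds in \<open>auto simp: p_def\<close>)
qed

context
  fixes p :: "nat \<Rightarrow> real"
  assumes F0: "F 0 = 0" and p_0: "p 0 = 1" and p_Suc: "\<And>n. F (p (Suc n)) = p n"
    and p_pos: "\<And>n. 0 < p n" and p_le_1: "\<And>n. p n \<le> 1"
begin

lemma funpow_backward_orbit: "(F ^^ n) (p n) = 1"
  by (induction n) (simp_all add: p_0 p_Suc funpow_Suc_right del: funpow.simps(2))

lemma deriv_along_backward_orbit: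
  "circle_deriv (f ^^ n) (circle_of (p n)) = (\<Prod>k<n. D (p (Suc k)))"
  unfolding circle_deriv_funpow
proof (induction n)
  case (Suc n)
  have "(\<Prod>k<Suc n. D ((F ^^ k) (p (Suc n)))) = D (p (Suc n)) * (\<Prod>k<n. D ((F ^^ k) (p n)))"
    by (simp add: prod.lessThan_Suc_shift p_Suc funpow_Suc_right del: funpow.simps(2) prod.lessThan_Suc)
  with Suc show ?case by (simp add: mult.commute)
qed simp

lemma backward_orbit_upper: "p n \<le> (1 / \<mu>) ^ n"
  using funpow_expands[of 0 "p n" n] p_pos[of n] rate_gt_1
  by (simp add: fixed_funpow[OF F0] funpow_backward_orbit field_simps power_one_over)

lemma backward_orbit_lower:
  assumes "1 < B" "\<And>t. D t \<le> B"
  shows "(1 / B) ^ n \<le> p n"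
proof (induction n)
  case (Suc n)
  obtain z where "F (p (Suc n)) - F 0 = D z * (p (Suc n) - 0)"
    using mean_value[OF p_pos] .
  then have "p n \<le> B * p (Suc n)"
    using assms(2)[of z] p_pos[of "Suc n"] by (simp add: F0 p_Suc)
  with Suc have "(1 / B) ^ n \<le> B * p (Suc n)" by linarith
  with assms(1) show ?case by (simp add: field_simps)
qed (simp add: p_0)

lemma backward_orbit_domain: "{0..p n} \<in> injectivity_domains f n"
proof -
  have "(f ^^ n) (circle_of t) = circle_of ((F ^^ n) t)" for t
    using lift_funpow[of n] by (simp add: circle_lift_def)
  moreover have "(F ^^ n) t \<notin> \<int>" if "0 < t" "t < p n" for t
  proof -
    have "0 < (F ^^ n) t" "(F ^^ n) t < 1"
      using strict_monoD[OF strict_mono_funpow that(1), of n]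
        strict_monoD[OF strict_mono_funpow that(2), of n]
      by (simp_all add: fixed_funpow[OF F0] funpow_backward_orbit)
    then show ?thesis by (auto elim!: Ints_cases)
  qed
  ultimately show ?thesis
    unfolding injectivity_domains_def using p_pos[of n] p_le_1[of n]
    by (auto simp: fixed_funpow[OF F0] funpow_backward_orbit circle_of_eq_iff
        intro!: exI[of _ 0] exI[of _ "p n"])
qed

text \<open>The domain \<open>[0,p\<^sub>n]\<close> is tested at its endpoints, the fixed point \<open>0\<close> being the
  denominator.\<close>

lemma distortion_along_backward_orbit:
  assumes "bounded_distortion f"
  obtains C where "\<And>n. (\<Sum>k<n. ln (D (p (Suc k)) / D 0)) \<le> C"
proof -
  obtain C where C: "\<And>n J s t. 1 \<le> n \<Longrightarrow> J \<in> injectivity_domains f n \<Longrightarrow> s \<in> J \<Longrightarrow> t \<in> J \<Longrightarrow>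
      ln (circle_deriv (f ^^ n) (circle_of s) / circle_deriv (f ^^ n) (circle_of t)) \<le> C"
    using assms unfolding bounded_distortion_iff by blast
  \<comment> \<open>The constant \<open>C\<close> is only available for \<open>n \<ge> 1\<close>; the empty sum requires a nonnegative bound.\<close>
  have "(\<Sum>k<n. ln (D (p (Suc k)) / D 0)) \<le> max 0 C" for n
  proof (cases "n = 0")
    case False
    have "(\<Sum>k<n. ln (D (p (Suc k)) / D 0)) = ln (\<Prod>k<n. D (p (Suc k)) / D 0)"
      by (intro ln_prod[symmetric]) (simp_all add: D_pos D_nonzero)
    also have "\<dots> = ln (circle_deriv (f ^^ n) (circle_of (p n)) / circle_deriv (f ^^ n) (circle_of 0))"
      unfolding deriv_along_backward_orbit
      by (simp add: circle_deriv_funpow fixed_funpow[OF F0] prod_dividef)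
    also have "\<dots> \<le> C"
      using False p_pos[of n] by (intro C[OF _ backward_orbit_domain]) auto
    finally show ?thesis by simp
  qed simp
  then show thesis using that by blast
qed

end

text \<open>Near the fixed point the terms \<open>ln (D p\<^sub>k / D 0)\<close> equal \<open>ln (1 + \<omega> p\<^sub>k)\<close>. They are nonnegative,
  so bounded partial sums already give convergence, and they are comparable to \<open>\<omega> p\<^sub>k\<close> because
  \<open>\<omega> p\<^sub>k\<close> stays bounded. Monotonicity then passes from \<open>p\<^sub>k\<close> down to \<open>(1 / B) ^ k\<close>.\<close>

lemma summable_modulus_at_fixed_point:
  assumes F0: "F 0 = 0" and "0 < t\<^sub>0" and mono: "mono_on {0..} \<omega>" and "\<omega> 0 = 0"
    and D_eq: "\<And>t. 0 \<le> t \<Longrightarrow> t \<le> t\<^sub>0 \<Longrightarrow> D t = 2 + 2 * \<omega> t"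
    and B: "1 < B" "\<And>t. D t \<le> B"
    and "bounded_distortion f"
  shows "summable (\<lambda>j. \<omega> ((1 / B) ^ j))"
proof -
  obtain p where p: "p 0 = 1" "\<And>n. F (p (Suc n)) = p n" "\<And>n. 0 < p n" "\<And>n. p n \<le> 1"
    using backward_orbit[OF F0] by blast
  obtain C where C: "\<And>n. (\<Sum>k<n. ln (D (p (Suc k)) / D 0)) \<le> C"
    using distortion_along_backward_orbit[OF F0 p \<open>bounded_distortion f\<close>] by blast
  have \<omega>_nonneg: "0 \<le> \<omega> t" if "0 \<le> t" for t
    using mono_onD[OF mono, of 0 t] that \<open>\<omega> 0 = 0\<close> by simp
  have D0: "D 0 = 2" using D_eq[of 0] \<open>0 < t\<^sub>0\<close> \<open>\<omega> 0 = 0\<close> by simp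
  obtain m where m: "(1 / \<mu>) ^ m < t\<^sub>0"
    using real_arch_pow_inv[OF \<open>0 < t\<^sub>0\<close>, of "1 / \<mu>"] rate_gt_1 by auto
  have small: "p n \<le> t\<^sub>0" if "m \<le> n" for n
  proof -
    have "(1 / \<mu>) ^ n \<le> (1 / \<mu>) ^ m"
      using rate_gt_1 that by (intro power_decreasing) auto
    with backward_orbit_upper[OF F0 p, of n] m show ?thesis by linarith
  qed
  \<comment> \<open>The first \<open>m\<close> points may lie outside the interval where \<open>D = 2 + 2 \<omega>\<close>; they contribute only
    a fixed finite sum.\<close>
  define L where "L k = ln (D (p (Suc (k + m))) / D 0)" for k
  have L_eq: "L k = ln (1 + \<omega> (p (Suc (k + m))))" for k
    unfolding L_def D0 using D_eq[of "p (Suc (k + m))"] small[of "Suc (k + m)"] p(3)[of "Suc (k + m)"]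
    by (simp add: add_divide_distrib)
  have L_nonneg: "0 \<le> L k" for k
    unfolding L_eq using \<omega>_nonneg p(3)[of "Suc (k + m)"] by simp
  have "summable L"
  proof (rule bounded_imp_summable[OF L_nonneg])
    fix n
    let ?l = "\<lambda>k. ln (D (p (Suc k)) / D 0)"
    have "(\<Sum>k<m. ?l k) + (\<Sum>k<N. L k) = (\<Sum>k<N + m. ?l k)" for N
      unfolding L_def by (induction N) (simp_all add: add.assoc)
    from this[of "Suc n"] show "(\<Sum>k\<le>n. L k) \<le> C - (\<Sum>k<m. ?l k)"
      using C[of "Suc n + m"] by (simp add: lessThan_Suc_atMost)
  qed
  \<comment> \<open>From \<open>x / (1 + x) \<le> ln (1 + x)\<close> and \<open>x \<le> \<omega> t\<^sub>0\<close> one gets \<open>x \<le> (1 + \<omega> t\<^sub>0) * ln (1 + x)\<close>.\<close>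
  let ?M = "1 + \<omega> t\<^sub>0"
  have bound: "\<omega> ((1 / B) ^ (k + Suc m)) \<le> ?M * L k" for k
  proof -
    define x where "x = \<omega> (p (Suc (k + m)))"
    have x: "0 \<le> x" "x \<le> \<omega> t\<^sub>0"
      unfolding x_def using p(3)[of "Suc (k + m)"] small[of "Suc (k + m)"] \<open>0 < t\<^sub>0\<close>
      by (auto intro!: \<omega>_nonneg mono_onD[OF mono])
    have "\<omega> ((1 / B) ^ (k + Suc m)) \<le> x"
      unfolding x_def using backward_orbit_lower[OF F0 p B, of "Suc (k + m)"] B(1) p(3)[of "Suc (k + m)"]
      by (intro mono_onD[OF mono]) auto
    also have "x = (1 + x) * (x / (1 + x))"
      using x by simp
    also have "\<dots> \<le> (1 + x) * ln (1 + x)"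
    proof (intro mult_left_mono)
      have "ln (1 / (1 + x)) \<le> 1 / (1 + x) - 1"
        using x by (intro ln_le_minus_one) simp
      then show "x / (1 + x) \<le> ln (1 + x)"
        using x by (simp add: ln_div field_simps)
    qed (use x in simp)
    also have "\<dots> \<le> ?M * ln (1 + x)"
      using x by (intro mult_right_mono) auto
    finally show ?thesis by (simp add: L_eq x_def)
  qed
  have "summable (\<lambda>k. \<omega> ((1 / B) ^ (k + Suc m)))"
  proof (rule summable_comparison_test'[of "\<lambda>k. ?M * L k" 0])
    show "summable (\<lambda>k. ?M * L k)" using \<open>summable L\<close> by (rule summable_mult)
    show "norm (\<omega> ((1 / B) ^ (k + Suc m))) \<le> ?M * L k" if "0 \<le> k" for k
      using bound[of k] \<omega>_nonneg[of "(1 / B) ^ (k + Suc m)"] B(1) by simp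
  qed
  then show ?thesis by (subst (asm) summable_iff_shift)
qed

lemma Dini_if_bounded_distortion:
  assumes "F 0 = 0" "0 < t\<^sub>0" "mono_on {0..} \<omega>" "\<omega> 0 = 0"
    and "\<And>t. 0 \<le> t \<Longrightarrow> t \<le> t\<^sub>0 \<Longrightarrow> D t = 2 + 2 * \<omega> t"
    and equiv: "moduli_equiv (canonical_modulus (circle_deriv f)) \<omega>"
    and "bounded_distortion f"
  shows "Dini_integrable (canonical_modulus (circle_deriv f))"
proof -
  obtain B where B: "1 < B" "\<And>t. D t \<le> B" using D_bounded by blast
  then have q: "0 < 1 / B" "1 / B < 1" by auto
  have summable: "summable (\<lambda>j. \<omega> ((1 / B) ^ j))"
    using summable_modulus_at_fixed_point[OF assms(1-5) B \<open>bounded_distortion f\<close>] .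
  obtain t\<^sub>1 c C where t1: "0 < t\<^sub>1" and c: "0 < c"
    and ratio: "\<And>t. t \<in> {0<..t\<^sub>1} \<Longrightarrow> c \<le> canonical_modulus (circle_deriv f) t / \<omega> t
      \<and> canonical_modulus (circle_deriv f) t / \<omega> t \<le> C"
    using equiv unfolding moduli_equiv_def by blast
  have le: "canonical_modulus (circle_deriv f) t \<le> C * \<omega> t" if t: "0 < t" "t \<le> t\<^sub>1" for t
  proof -
    have "\<omega> t \<noteq> 0" using ratio[of t] t c by auto
    moreover have "0 \<le> \<omega> t"
      using mono_onD[OF assms(3), of 0 t] t assms(4) by simp
    ultimately show ?thesis using ratio[of t] t by (simp add: field_simps)
  qed
  obtain N where N: "(1 / B) ^ N < t\<^sub>1"
    using real_arch_pow_inv[OF t1 q(2)] by blast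
  have "summable (\<lambda>j. canonical_modulus (circle_deriv f) ((1 / B) ^ j))"
  proof (rule summable_comparison_test'[of "\<lambda>j. C * \<omega> ((1 / B) ^ j)" N])
    show "summable (\<lambda>j. C * \<omega> ((1 / B) ^ j))" using summable by (rule summable_mult)
    fix j assume "N \<le> j"
    then have "(1 / B) ^ j \<le> (1 / B) ^ N"
      using q by (intro power_decreasing) auto
    with N have "(1 / B) ^ j \<le> t\<^sub>1" by linarith
    moreover have "0 < (1 / B) ^ j" using q by simp
    ultimately show "norm (canonical_modulus (circle_deriv f) ((1 / B) ^ j)) \<le> C * \<omega> ((1 / B) ^ j)"
      using le[of "(1 / B) ^ j"] modulus_nonneg[of "(1 / B) ^ j"] by simp
  qed
  then show ?thesis using Dini_modulus_iff_summable[OF q] by simp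
qed

end

section \<open>The lift of a map in the class\<close>

text \<open>Smoothness and monotonicity are given by two possibly different lifts; as these differ by
  a constant, a single lift has both properties. Monotonicity fixes the sign of the derivative, so
  the lower bound on \<open>\<bar>f'\<bar>\<close> becomes one on \<open>f'\<close>. Subtracting the integer \<open>H 0\<close>
  normalises the lift at the fixed point.\<close>

lemma expanding_lift_exists:
  assumes "f \<in> expanding_E1" "orientation_preserving f" "f (circle_of 0) = circle_of 0"
  obtains F D \<mu> where "expanding_lift f F D \<mu>" "F 0 = 0"
proof -
  obtain H where H: "circle_lift f H" "H C1_differentiable_on UNIV"
    using assms(1) unfolding expanding_E1_def C1_circle_map_def by blast
  then obtain D where D: "\<And>t. (H has_real_derivative D t) (at t)" "continuous_on UNIV D"
    unfolding C1_differentiable_on_def has_real_derivative_iff_has_vector_derivative by auto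
  obtain M where M: "circle_lift f M" "strict_mono M"
    using assms(2) unfolding orientation_preserving_def by blast
  obtain k :: int where k: "\<And>t. H t = M t + of_int k"
    using circle_lift_unique[OF H(1) M(1)] by blast
  have "mono H"
    using M(2) k by (auto intro!: monoI simp: strict_mono_less_eq)
  then have "0 \<le> D t" for t
    using mono_on_imp_deriv_nonneg[of UNIV H "D t" t] D(1) by simp
  moreover have D_eq: "circle_deriv f (circle_of t) = D t" for t
    using H(1) D(1) by (intro circle_deriv_eqI) (auto simp: has_circle_derivative_def)
  moreover have "(INF x. \<bar>circle_deriv f x\<bar>) \<le> \<bar>circle_deriv f (circle_of t)\<bar>" for t
    by (intro cINF_lower bdd_belowI[of _ 0]) auto
  ultimately have rate: "(INF x. \<bar>circle_deriv f x\<bar>) \<le> D t" for t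
    by (metis abs_of_nonneg)
  have "circle_of (H 0) = circle_of 0"
    using H(1) assms(3) by (simp add: circle_lift_def)
  then have "H 0 \<in> \<int>" by (simp add: circle_of_eq_iff)
  then have "circle_of (H t - H 0) = circle_of (H t)" for t
    by (simp add: circle_of_eq_iff)
  then have lift: "circle_lift f (\<lambda>t. H t - H 0)"
    using H(1) by (auto simp: circle_lift_def intro!: continuous_intros)
  have "expanding_lift f (\<lambda>t. H t - H 0) D (INF x. \<bar>circle_deriv f x\<bar>)"
  proof
    show "((\<lambda>t. H t - H 0) has_real_derivative D t) (at t)" for t
      using D(1)[of t] by (auto intro!: derivative_eq_intros)
    show "1 < (INF x. \<bar>circle_deriv f x\<bar>)"
      using assms(1) by (simp add: expanding_E1_def)
  qed (fact lift D(2) rate)+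
  then show thesis by (rule that) simp
qed

text \<open>A branch and the lift differ by a continuous integer-valued function on an interval, hence
  by a constant, so the one-sided derivatives of the branch are those of the lift.\<close>

lemma branch_derivative_eq:
  assumes "circle_lift f F" "full_branch f {0..a} g" "0 < a" "t \<in> {0..a}"
    and F': "(F has_real_derivative D) (at t)"
    and g': "(g has_real_derivative E) (at t within {0..a})"
  shows "D = E"
proof -
  have ints: "F u - g u \<in> \<int>" if "u \<in> {0..a}" for u
    using assms(1,2) that unfolding circle_lift_def full_branch_def
    by (simp flip: circle_of_eq_iff)
  have "continuous_on {0..a} (\<lambda>u. F u - g u)"
    using assms(1,2) unfolding circle_lift_def full_branch_def
    by (intro continuous_on_diff) (auto intro: continuous_on_subset)
  then have "(\<lambda>u. F u - g u) constant_on {0..a}"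
  proof (rule continuous_discrete_range_constant[rotated])
    fix x assume x: "x \<in> {0..a}"
    have "1 \<le> norm ((F y - g y) - (F x - g x))" if "y \<in> {0..a}" "F y - g y \<noteq> F x - g x" for y
      using Ints_diff[OF ints[OF that(1)] ints[OF x]] that(2) by (simp add: Ints_nonzero_abs_ge1)
    then show "\<exists>e>0. \<forall>y. y \<in> {0..a} \<and> F y - g y \<noteq> F x - g x
        \<longrightarrow> e \<le> norm ((F y - g y) - (F x - g x))"
      using zero_less_one by blast
  qed simp
  then obtain c where c: "\<And>u. u \<in> {0..a} \<Longrightarrow> F u = g u + c"
    by (auto simp: constant_on_def algebra_simps)
  have "((\<lambda>u. g u + c) has_real_derivative E) (at t within {0..a})"
    using g' by (auto intro!: derivative_eq_intros)
  then have "(F has_real_derivative E) (at t within {0..a})"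
    by (rule has_field_derivative_transform_within[of _ _ _ _ 1]) (use assms(4) c in auto)
  moreover have "(F has_real_derivative D) (at t within {0..a})"
    using F' by (rule has_field_derivative_at_within)
  moreover have "at t within {0..a} \<noteq> bot"
    using assms(3,4) by (simp add: trivial_limit_within islimpt_Icc)
  ultimately show ?thesis using has_field_derivative_unique by blast
qed

theorem theorem3:
  fixes \<omega> :: "real \<Rightarrow> real" and f :: "circle \<Rightarrow> circle"
  assumes "\<omega> \<in> moduli_K" and "f \<in> class_F \<omega>"
  shows "bounded_distortion f \<longleftrightarrow> Dini_integrable (canonical_modulus (circle_deriv f))"
proof -
  have f: "f \<in> expanding_E1" "moduli_equiv (canonical_modulus (circle_deriv f)) \<omega>"
    "orientation_preserving f" "f (circle_of 0) = circle_of 0"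
    using assms(2) unfolding class_F_def expanding_E1_modulus_def by auto
  obtain a g t\<^sub>0 where a: "0 < a" and g: "full_branch f {0..a} g"
    and t0: "0 < t\<^sub>0" "t\<^sub>0 \<le> a"
    and g': "\<And>t. t \<in> {0..t\<^sub>0} \<Longrightarrow> (g has_real_derivative 2 + 2 * \<omega> t) (at t within {0..a})"
    using assms(2) unfolding class_F_def by auto
  obtain F D \<mu> where "expanding_lift f F D \<mu>" and F0: "F 0 = 0"
    using expanding_lift_exists[OF f(1,3,4)] by blast
  then interpret expanding_lift f F D \<mu> by simp
  have D_eq: "D t = 2 + 2 * \<omega> t" if "0 \<le> t" "t \<le> t\<^sub>0" for t
    using branch_derivative_eq[OF lift g a _ deriv g'] that t0 by auto
  have \<omega>: "mono_on {0..} \<omega>" "\<omega> 0 = 0"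
    using assms(1) by (auto simp: moduli_K_def)
  show ?thesis
    using bounded_distortion_if_Dini Dini_if_bounded_distortion[OF F0 t0(1) \<omega> D_eq f(2)] by blast
qed

end
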